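(* Let $\mathcal{M}=\{|m_i\rangle\langle m_i|\}$ and $\mathcal{N}=\{|n_j\rangle\langle n_j|\}$ be two (finite) POVMs with rank-one elements in a $d$-dimensional complex Hilbert space $\mathcal{H}$. To any density matrix $\rho$ on $\mathcal{H}$ assign the quantity $$g(\mathcal{M},\mathcal{N}|\rho)=\max\left\{\frac{\bigl|\langle m_i|n_j\rangle\,\langle n_j|\rho|m_i\rangle\bigr|}{\langle m_i|\rho|m_i\rangle^{1/2}\,\langle n_j|\rho|n_j\rangle^{1/2}}:\ \langle m_i|\rho|m_i\rangle\neq0,\ \langle n_j|\rho|n_j\rangle\neq0\right\}.$$ Then for all real $\alpha,\beta>0$ with $1/\alpha+1/\beta=2$, and $\mu=\max\{\alpha,\beta\}$, $$H_\alpha(\mathcal{M}|\rho)+H_\beta(\mathcal{N}|\rho)\;\ge\;\ln_\mu\!\left(g(\mathcal{M},\mathcal{N}|\rho)^{-2}\right),$$ $$R_\alpha(\mathcal{M}|\rho)+R_\beta(\mathcal{N}|\rho)\;\ge\;-2\ln g(\mathcal{M},\mathcal{N}|\rho).$$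
   Context: A density matrix on $\mathcal{H}$ is a positive semidefinite operator of trace $1$. A POVM is a set of positive semidefinite operators summing to the identity; here the vectors $|m_i\rangle$, $|n_j\rangle$ need not be normalized, and $\sum_i|m_i\rangle\langle m_i|=\sum_j|n_j\rangle\langle n_j|=\mathbf{1}$. The outcome probabilities in state $\rho$ are $\langle m_i|\rho|m_i\rangle$ for $\mathcal{M}$ and $\langle n_j|\rho|n_j\rangle$ for $\mathcal{N}$. For $x>0$ and $\alpha>0$, $\alpha\ne1$, $\ln_\alpha(x)=\frac{x^{1-\alpha}-1}{1-\alpha}$, and $\ln_1(x)=\ln x$. For a probability distribution $p=\{p_j\}$ and $\alpha>0$, $\alpha\neq1$, the Tsallis entropy is $H_\alpha(p)=\frac{1}{1-\alpha}\bigl(\sum_j p_j^\alpha-1\bigr)$ and the Rényi entropy is $R_\alpha(p)=\frac{1}{1-\alpha}\ln\bigl(\sum_j p_j^\alpha\bigr)$, with sums over $j$ with $p_j>0$; for $\alpha=1$ both are the Shannon entropy $-\sum_j p_j\ln p_j$. $H_\alpha(\mathcal{M}|\rho)$, $R_\alpha(\mathcal{M}|\rho)$, etc., denote the entropies of the corresponding outcome distributions. *)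

theory Defs
  imports "HOL-Analysis.Analysis"
begin

text \<open>
  Operators on the \<open>d\<close>-dimensional space \<^typ>\<open>complex ^ 'd\<close> are square complex matrices.  The
  library inner product \<^const>\<open>inner\<close> on this type is real-valued, hence the sesquilinear one here
  (antilinear in the first argument); \<open>braket u (A *v v)\<close> is the matrix element \<open>\<langle>u|A|v\<rangle>\<close>.
\<close>

definition braket :: "complex ^ 'd \<Rightarrow> complex ^ 'd \<Rightarrow> complex" where
  "braket u v = (\<Sum>k\<in>UNIV. cnj (u $ k) * v $ k)"

definition ketbra :: "complex ^ 'd \<Rightarrow> complex ^ 'd ^ 'd" where
  "ketbra u = (\<chi> k l. u $ k * cnj (u $ l))"

text \<open>
  Membership in \<open>\<real>\<^sub>\<ge>\<^sub>0\<close> says that the complex number is real and nonnegative, so positive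
  semidefinite matrices are in particular Hermitian.
\<close>

definition positive_semidefinite :: "complex ^ 'd ^ 'd \<Rightarrow> bool" where
  "positive_semidefinite A \<longleftrightarrow> (\<forall>v. braket v (A *v v) \<in> \<real>\<^sub>\<ge>\<^sub>0)"

definition density_matrix :: "complex ^ 'd ^ 'd \<Rightarrow> bool" where
  "density_matrix \<rho> \<longleftrightarrow> positive_semidefinite \<rho> \<and> trace \<rho> = 1"

definition povm :: "('i::finite \<Rightarrow> complex ^ 'd ^ 'd) \<Rightarrow> bool" where
  "povm E \<longleftrightarrow> (\<forall>i. positive_semidefinite (E i)) \<and> (\<Sum>i\<in>UNIV. E i) = mat 1"

text \<open>The measurement with elements \<open>|m i\<rangle>\<langle>m i|\<close> is represented by the family \<open>m\<close> of vectors.\<close>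

definition rank_one_povm :: "('i::finite \<Rightarrow> complex ^ 'd) \<Rightarrow> bool" where
  "rank_one_povm m \<longleftrightarrow> povm (\<lambda>i. ketbra (m i)) \<and> (\<forall>i. rank (ketbra (m i)) = 1)"

text \<open>For positive semidefinite \<open>\<rho>\<close> the number \<open>\<langle>m i|\<rho>|m i\<rangle>\<close> is real, so \<open>Re\<close> only changes its type.\<close>

definition outcome_prob :: "('i::finite \<Rightarrow> complex ^ 'd) \<Rightarrow> complex ^ 'd ^ 'd \<Rightarrow> 'i \<Rightarrow> real" where
  "outcome_prob m \<rho> i = Re (braket (m i) (\<rho> *v m i))"

definition shannon_entropy :: "('i::finite \<Rightarrow> real) \<Rightarrow> real" where
  "shannon_entropy p = - (\<Sum>j | p j > 0. p j * ln (p j))"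

definition tsallis_entropy :: "real \<Rightarrow> ('i::finite \<Rightarrow> real) \<Rightarrow> real" where
  "tsallis_entropy \<alpha> p =
     (if \<alpha> = 1 then shannon_entropy p
      else 1 / (1 - \<alpha>) * ((\<Sum>j | p j > 0. p j powr \<alpha>) - 1))"

definition renyi_entropy :: "real \<Rightarrow> ('i::finite \<Rightarrow> real) \<Rightarrow> real" where
  "renyi_entropy \<alpha> p =
     (if \<alpha> = 1 then shannon_entropy p
      else 1 / (1 - \<alpha>) * ln (\<Sum>j | p j > 0. p j powr \<alpha>))"

definition tsallis_ln :: "real \<Rightarrow> real \<Rightarrow> real" where
  "tsallis_ln \<alpha> x = (if \<alpha> = 1 then ln x else (x powr (1 - \<alpha>) - 1) / (1 - \<alpha>))"

text \<open>
  If \<open>m\<close> and \<open>n\<close> give POVMs and \<open>\<rho>\<close> is a density matrix, the set below is nonempty, since each of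
  the two outcome distributions sums to \<open>1\<close>; hence \<^const>\<open>Max\<close> is a genuine maximum.
\<close>

definition overlap ::
  "('i::finite \<Rightarrow> complex ^ 'd) \<Rightarrow> ('j::finite \<Rightarrow> complex ^ 'd) \<Rightarrow> complex ^ 'd ^ 'd \<Rightarrow> real" where
  "overlap m n \<rho> =
     Max {cmod (braket (m i) (n j) * braket (n j) (\<rho> *v m i)) /
            (sqrt (outcome_prob m \<rho> i) * sqrt (outcome_prob n \<rho> j)) | i j.
          outcome_prob m \<rho> i \<noteq> 0 \<and> outcome_prob n \<rho> j \<noteq> 0}"

end

theory Submission
  imports Defs "HOL-Complex_Analysis.Conformal_Mappings"
begin

text \<open>
  Put \<open>p i = \<langle>m i|\<rho>|m i\<rangle>\<close>, \<open>q j = \<langle>n j|\<rho>|n j\<rangle>\<close> and \<open>S i j = \<langle>m i|n j\<rangle> \<langle>n j|\<rho>|m i\<rangle>\<close>.  By completeness \<open>S\<close> has the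
  marginals \<open>p\<close> and \<open>q\<close>.  The kernel \<open>S i j / sqrt (p i * q j)\<close> is bounded entrywise by the overlap
  \<open>g\<close>, and it is a contraction for the Euclidean norms, by Bessel's inequality for the semi-inner
  product \<open>\<langle>u|\<rho>|v\<rangle>\<close>.  Interpolating between the two bounds with the three lines theorem gives, for
  \<open>\<alpha> > 1\<close>, \<open>(\<Sum>i. p i powr \<alpha>) powr (1 / \<alpha>) \<le> g powr (2 - 2 / \<alpha>) * (\<Sum>j. q j powr \<beta>) powr (1 / \<beta>)\<close>, whose
  logarithm is the Renyi inequality.  The Shannon case is its derivative at \<open>\<alpha> = 1\<close>, the Tsallis
  inequality follows by a subadditivity argument, and \<open>\<alpha> < 1\<close> is the transposed situation.
\<close>

subsection \<open>The semi-inner product of a positive semidefinite matrix\<close>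

definition form :: "complex ^ 'd ^ 'd \<Rightarrow> complex ^ 'd \<Rightarrow> complex ^ 'd \<Rightarrow> complex" where
  "form A u v = braket u (A *v v)"

lemma braket_sum_left: "braket (\<Sum>i\<in>I. f i) v = (\<Sum>i\<in>I. braket (f i) v)"
  unfolding braket_def by (simp add: cnj_sum sum_distrib_right) (rule sum.swap)

lemma braket_sum_right: "braket u (\<Sum>i\<in>I. f i) = (\<Sum>i\<in>I. braket u (f i))"
  unfolding braket_def by (simp add: sum_distrib_left) (rule sum.swap)

lemma braket_scale_left: "braket (c *s u) v = cnj c * braket u v"
  unfolding braket_def by (simp add: sum_distrib_left mult_ac)

lemma braket_scale_right: "braket u (c *s v) = c * braket u v"
  unfolding braket_def by (simp add: sum_distrib_left mult_ac)

lemma form_sum_left: "form A (\<Sum>i\<in>I. f i) v = (\<Sum>i\<in>I. form A (f i) v)"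
  unfolding form_def by (rule braket_sum_left)

lemma matrix_vector_mult_sum_right:
  fixes A :: "complex ^ 'n ^ 'm"
  shows "A *v (\<Sum>i\<in>I. f i) = (\<Sum>i\<in>I. A *v f i)"
  by (induction I rule: infinite_finite_induct) (simp_all add: matrix_vector_right_distrib)

lemma form_sum_right: "form A u (\<Sum>i\<in>I. f i) = (\<Sum>i\<in>I. form A u (f i))"
  unfolding form_def by (simp add: matrix_vector_mult_sum_right braket_sum_right)

lemma form_scale_left: "form A (c *s u) v = cnj c * form A u v"
  unfolding form_def by (rule braket_scale_left)

lemma form_scale_right: "form A u (c *s v) = c * form A u v"
  unfolding form_def by (simp add: vector_scalar_commute braket_scale_right)

lemma form_add_left: "form A (u + v) w = form A u w + form A v w"
  unfolding form_def braket_def by (simp add: algebra_simps sum.distrib)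

lemma form_add_right: "form A w (u + v) = form A w u + form A w v"
  unfolding form_def braket_def
  by (simp add: matrix_vector_right_distrib algebra_simps sum.distrib)

lemma form_diff_left: "form A (u - v) w = form A u w - form A v w"
  unfolding form_def braket_def by (simp add: algebra_simps sum_subtractf)

lemma form_diff_right: "form A w (u - v) = form A w u - form A w v"
  unfolding form_def braket_def
  by (simp add: matrix_vector_mult_diff_distrib algebra_simps sum_subtractf)

lemma form_nonneg:
  assumes "positive_semidefinite A"
  shows "0 \<le> Re (form A v v)" and "Im (form A v v) = 0"
  using assms unfolding positive_semidefinite_def form_def
  by (auto simp: complex_nonneg_Reals_iff)

text \<open>Polarization: the diagonal values at \<open>u + v\<close> and at
  \<open>u + \<i> *s v\<close> are real. The first fact makes the imaginary parts of the two mixed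
  terms cancel, the second makes their real parts agree.\<close>

lemma form_cnj:
  assumes "positive_semidefinite A"
  shows "form A v u = cnj (form A u v)"
proof -
  have "Im (form A (u + v) (u + v)) = 0" "Im (form A (u + \<i> *s v) (u + \<i> *s v)) = 0"
    "Im (form A u u) = 0" "Im (form A v v) = 0"
    using form_nonneg(2)[OF assms] by blast+
  then show ?thesis
    by (auto simp: form_add_left form_add_right form_scale_left form_scale_right complex_eq_iff)
qed

lemma form_Cauchy_Schwarz:
  assumes "positive_semidefinite A"
  shows "(cmod (form A u v))\<^sup>2 \<le> Re (form A u u) * Re (form A v v)"
proof -
  define c where "c = form A u v"
  have vu: "form A v u = cnj c" unfolding c_def by (rule form_cnj[OF assms])
  have uu: "form A u u = of_real (Re (form A u u))" and vv: "form A v v = of_real (Re (form A v v))"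
    using form_nonneg(2)[OF assms] by (simp_all add: complex_eq_iff)
  \<comment> \<open>The coefficient of \<open>v\<close> is \<open>t * cnj c\<close>; this phase
    makes both cross terms equal to the real number \<open>t * (cmod c)\<^sup>2\<close>.\<close>
  have quad: "0 \<le> Re (form A u u) + 2 * t * (cmod c)\<^sup>2 + t\<^sup>2 * (cmod c)\<^sup>2 * Re (form A v v)" for t :: real
  proof -
    define s where "s = of_real t * cnj c"
    have "form A (u + s *s v) (u + s *s v)
        = form A u u + s * c + cnj s * cnj c + cnj s * s * form A v v"
      by (simp add: form_add_left form_add_right form_scale_left form_scale_right vu
          flip: c_def) (simp add: algebra_simps)
    also have "\<dots> = of_real (Re (form A u u) + 2 * t * (cmod c)\<^sup>2 + t\<^sup>2 * (cmod c)\<^sup>2 * Re (form A v v))"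
      unfolding s_def using complex_norm_square[of c]
      by (subst uu, subst vv) (simp add: algebra_simps power2_eq_square)
    finally show ?thesis
      using form_nonneg(1)[OF assms, of "u + s *s v"] by (simp del: of_real_add of_real_mult)
  qed
  have a: "0 \<le> Re (form A u u)" and b: "0 \<le> Re (form A v v)" using form_nonneg[OF assms] by auto
  show ?thesis
  proof (cases "c = 0")
    case True then show ?thesis using a b by (simp add: c_def)
  next
    case False
    then have c: "0 < (cmod c)\<^sup>2" by simp
    show ?thesis
    proof (cases "Re (form A v v) = 0")
      case True
      \<comment> \<open>In the degenerate case the quadratic is affine in \<open>t\<close> with
        positive slope, and this \<open>t\<close> gives it the value -1.\<close>
      have "0 \<le> Re (form A u u) + 2 * (- (Re (form A u u) + 1) / (2 * (cmod c)\<^sup>2)) * (cmod c)\<^sup>2"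
        using quad[of "- (Re (form A u u) + 1) / (2 * (cmod c)\<^sup>2)"] True by simp
      then have False using c \<open>c \<noteq> 0\<close> by (simp add: field_simps)
      then show ?thesis ..
    next
      case False
      then have b: "Re (form A v v) > 0" using b by simp
      show ?thesis
        \<comment> \<open>This \<open>t\<close> minimizes the quadratic.\<close>
        using quad[of "- 1 / Re (form A v v)"] b c
        by (simp add: field_simps power2_eq_square flip: c_def)
    qed
  qed
qed

section \<open>Completeness of rank-one measurements and Bessel's inequality\<close>

text \<open>The resolution of the identity in coordinates. Read the other way, the rows
  \<open>\<lambda>i. m i $ k\<close>, indexed by the coordinate \<open>k\<close>, form an
  orthonormal system.\<close>

lemma rank_one_povm_complete:
  assumes "rank_one_povm m"
  shows "(\<Sum>i\<in>UNIV. m i $ k * cnj (m i $ l)) = (if k = l then 1 else 0)"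
proof -
  have "(\<Sum>i\<in>UNIV. ketbra (m i)) = mat 1"
    using assms unfolding rank_one_povm_def povm_def by blast
  then have "(\<Sum>i\<in>UNIV. ketbra (m i)) $ k $ l = mat 1 $ k $ l" by simp
  then show ?thesis by (simp add: ketbra_def mat_def)
qed

text \<open>The rows of \<open>m\<close> are orthonormal, and \<open>u k\<close> is the
  vector-valued coefficient of the family \<open>x\<close> along row \<open>k\<close>. Subtracting
  the projection \<open>y\<close> of \<open>x\<close> onto their span leaves a residual of
  nonnegative total form, equal to the difference of the two sides.\<close>

lemma form_Bessel:
  fixes x :: "'i::finite \<Rightarrow> complex ^ 'd"
  assumes m: "rank_one_povm m" and A: "positive_semidefinite A"
    and u: "\<And>k. u k = (\<Sum>i\<in>UNIV. cnj (m i $ k) *s x i)"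
  shows "(\<Sum>k\<in>UNIV. Re (form A (u k) (u k))) \<le> (\<Sum>i\<in>UNIV. Re (form A (x i) (x i)))"
proof -
  define y where "y i = (\<Sum>k\<in>UNIV. m i $ k *s u k)" for i
  let ?U = "\<Sum>k\<in>UNIV. form A (u k) (u k)"
  have xy: "(\<Sum>i\<in>UNIV. form A (x i) (y i)) = ?U"
  proof -
    have "(\<Sum>i\<in>UNIV. form A (x i) (y i)) = (\<Sum>i\<in>UNIV. \<Sum>k\<in>UNIV. m i $ k * form A (x i) (u k))"
      by (simp add: y_def form_sum_right form_scale_right)
    also have "\<dots> = (\<Sum>k\<in>UNIV. \<Sum>i\<in>UNIV. m i $ k * form A (x i) (u k))" by (rule sum.swap)
    also have "\<dots> = ?U"
      by (subst (2) u) (simp add: form_sum_left form_scale_left)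
    finally show ?thesis .
  qed
  have yx: "(\<Sum>i\<in>UNIV. form A (y i) (x i)) = ?U"
  proof -
    have "(\<Sum>i\<in>UNIV. form A (y i) (x i)) = cnj (\<Sum>i\<in>UNIV. form A (x i) (y i))"
      by (simp add: form_cnj[OF A, symmetric])
    also have "\<dots> = ?U" by (simp add: xy form_cnj[OF A, symmetric])
    finally show ?thesis .
  qed
  have yy: "(\<Sum>i\<in>UNIV. form A (y i) (y i)) = ?U"
  proof -
    have "(\<Sum>i\<in>UNIV. form A (y i) (y i))
        = (\<Sum>i\<in>UNIV. \<Sum>k\<in>UNIV. \<Sum>l\<in>UNIV. (m i $ k * cnj (m i $ l)) * form A (u l) (u k))"
      by (simp add: y_def form_sum_right form_scale_right form_sum_left form_scale_left
          sum_distrib_left mult_ac)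
    also have "\<dots> = (\<Sum>k\<in>UNIV. \<Sum>i\<in>UNIV. \<Sum>l\<in>UNIV. (m i $ k * cnj (m i $ l)) * form A (u l) (u k))"
      by (rule sum.swap)
    also have "\<dots> = (\<Sum>k\<in>UNIV. \<Sum>l\<in>UNIV. \<Sum>i\<in>UNIV. (m i $ k * cnj (m i $ l)) * form A (u l) (u k))"
      by (rule sum.cong[OF refl], rule sum.swap)
    also have "\<dots> = (\<Sum>k\<in>UNIV. \<Sum>l\<in>UNIV. (if k = l then 1 else 0) * form A (u l) (u k))"
      by (simp only: flip: rank_one_povm_complete[OF m] sum_distrib_right)
    also have "\<dots> = ?U" by (simp add: if_distrib[of "\<lambda>c. c * _"] cong: if_cong)
    finally show ?thesis .
  qed
  have "0 \<le> Re (\<Sum>i\<in>UNIV. form A (x i - y i) (x i - y i))"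
    by (simp add: sum_nonneg form_nonneg[OF A])
  also have "(\<Sum>i\<in>UNIV. form A (x i - y i) (x i - y i)) = (\<Sum>i\<in>UNIV. form A (x i) (x i)) - ?U"
    using xy yx yy by (simp add: form_diff_left form_diff_right sum_subtractf)
  finally show ?thesis by simp
qed

lemma outcome_prob_form: "outcome_prob m A i = Re (form A (m i) (m i))"
  by (simp add: outcome_prob_def form_def)

lemma outcome_prob_sum:
  assumes m: "rank_one_povm m" and A: "density_matrix A"
  shows "(\<Sum>i\<in>UNIV. outcome_prob m A i) = 1"
proof -
  have "(\<Sum>i\<in>UNIV. form A (m i) (m i))
     = (\<Sum>i\<in>UNIV. \<Sum>k\<in>UNIV. \<Sum>l\<in>UNIV. A $ k $ l * (m i $ l * cnj (m i $ k)))"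
    by (simp add: form_def braket_def matrix_vector_mult_def sum_distrib_left mult_ac)
  also have "\<dots> = (\<Sum>k\<in>UNIV. \<Sum>i\<in>UNIV. \<Sum>l\<in>UNIV. A $ k $ l * (m i $ l * cnj (m i $ k)))"
    by (rule sum.swap)
  also have "\<dots> = (\<Sum>k\<in>UNIV. \<Sum>l\<in>UNIV. \<Sum>i\<in>UNIV. A $ k $ l * (m i $ l * cnj (m i $ k)))"
    by (rule sum.cong[OF refl], rule sum.swap)
  also have "\<dots> = trace A"
    by (simp add: rank_one_povm_complete[OF m] if_distrib[of "\<lambda>c. _ * c"] trace_def
        flip: sum_distrib_left cong: if_cong)
  also have "\<dots> = 1" using A by (simp add: density_matrix_def)
  finally have "Re (\<Sum>i\<in>UNIV. form A (m i) (m i)) = 1" by simp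
  then show ?thesis by (simp add: outcome_prob_form)
qed

lemma rank_one_povm_expand:
  assumes "rank_one_povm n"
  shows "v = (\<Sum>j\<in>UNIV. braket (n j) v *s n j)"
proof (rule vec_eq_iff[THEN iffD2], rule allI)
  fix k
  have "(\<Sum>j\<in>UNIV. braket (n j) v *s n j) $ k
      = (\<Sum>j\<in>UNIV. \<Sum>l\<in>UNIV. v $ l * (n j $ k * cnj (n j $ l)))"
    by (simp add: braket_def sum_distrib_left sum_distrib_right mult_ac)
  also have "\<dots> = (\<Sum>l\<in>UNIV. \<Sum>j\<in>UNIV. v $ l * (n j $ k * cnj (n j $ l)))" by (rule sum.swap)
  also have "\<dots> = v $ k"
    by (simp add: rank_one_povm_complete[OF assms] if_distrib[of "\<lambda>c. _ * c"]
        flip: sum_distrib_left cong: if_cong)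
  finally show "v $ k = (\<Sum>j\<in>UNIV. braket (n j) v *s n j) $ k" by simp
qed

section \<open>The complex joint distribution of the two measurements\<close>

text \<open>The Kirkwood-Dirac quasi-distribution of the state. Its modulus is the numerator in
  \<open>overlap\<close>.\<close>

definition joint_weight ::
  "('i::finite \<Rightarrow> complex ^ 'd) \<Rightarrow> ('j::finite \<Rightarrow> complex ^ 'd) \<Rightarrow> complex ^ 'd ^ 'd \<Rightarrow> 'i \<Rightarrow> 'j \<Rightarrow> complex"
  where "joint_weight m n A i j = braket (m i) (n j) * form A (n j) (m i)"

lemma of_real_outcome_prob:
  assumes "positive_semidefinite A"
  shows "of_real (outcome_prob m A i) = form A (m i) (m i)"
  using form_nonneg(2)[OF assms] by (simp add: outcome_prob_form complex_eq_iff)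

lemma cnj_braket: "cnj (braket u v) = braket v u"
  by (simp add: braket_def mult_ac)

text \<open>Expand the left copy of \<open>m i\<close> over the family \<open>n\<close>;
  antilinearity turns the coefficient \<open>braket (n j) (m i)\<close> into
  \<open>braket (m i) (n j)\<close>.\<close>

lemma joint_weight_marginal1:
  assumes "rank_one_povm n" "positive_semidefinite A"
  shows "(\<Sum>j\<in>UNIV. joint_weight m n A i j) = of_real (outcome_prob m A i)"
proof -
  have "form A (m i) (m i) = form A (\<Sum>j\<in>UNIV. braket (n j) (m i) *s n j) (m i)"
    using rank_one_povm_expand[OF assms(1), of "m i"] by simp
  also have "\<dots> = (\<Sum>j\<in>UNIV. joint_weight m n A i j)"
    by (simp add: form_sum_left form_scale_left cnj_braket joint_weight_def)
  finally show ?thesis by (simp add: of_real_outcome_prob[OF assms(2)])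
qed

lemma joint_weight_marginal2:
  assumes "rank_one_povm m" "positive_semidefinite A"
  shows "(\<Sum>i\<in>UNIV. joint_weight m n A i j) = of_real (outcome_prob n A j)"
proof -
  have "form A (n j) (n j) = form A (n j) (\<Sum>i\<in>UNIV. braket (m i) (n j) *s m i)"
    using rank_one_povm_expand[OF assms(1), of "n j"] by simp
  also have "\<dots> = (\<Sum>i\<in>UNIV. joint_weight m n A i j)"
    by (simp add: form_sum_right form_scale_right joint_weight_def)
  finally show ?thesis by (simp add: of_real_outcome_prob[OF assms(2)])
qed

lemma joint_weight_eq_0:
  assumes "positive_semidefinite A" "outcome_prob m A i = 0 \<or> outcome_prob n A j = 0"
  shows "joint_weight m n A i j = 0"
  using form_Cauchy_Schwarz[OF assms(1), of "n j" "m i"] assms(2)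
  by (auto simp: joint_weight_def outcome_prob_form)

text \<open>
  The coordinates \<open>k\<close> of \<open>\<langle>m i|n j\<rangle>\<close> decouple, and Bessel's inequality in the semi-inner product of
  the state applies to each of the two families separately.
\<close>

lemma joint_weight_bilinear_bound:
  assumes m: "rank_one_povm m" and n: "rank_one_povm n" and A: "positive_semidefinite A"
  shows "(cmod (\<Sum>i\<in>UNIV. \<Sum>j\<in>UNIV. a i * joint_weight m n A i j * b j))\<^sup>2
    \<le> (\<Sum>i\<in>UNIV. (cmod (a i))\<^sup>2 * outcome_prob m A i) * (\<Sum>j\<in>UNIV. (cmod (b j))\<^sup>2 * outcome_prob n A j)"
proof -
  define u where "u k = (\<Sum>i\<in>UNIV. cnj (m i $ k) *s (a i *s m i))" for k
  \<comment> \<open>\<open>b\<close> is conjugated because \<open>v k\<close> enters the antilinear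
    slot of \<open>form\<close>.\<close>
  define v where "v k = (\<Sum>j\<in>UNIV. cnj (n j $ k) *s (cnj (b j) *s n j))" for k
  have "(\<Sum>k\<in>UNIV. form A (v k) (u k))
      = (\<Sum>k\<in>UNIV. \<Sum>i\<in>UNIV. \<Sum>j\<in>UNIV. (cnj (m i $ k) * n j $ k) * (a i * b j * form A (n j) (m i)))"
    by (simp add: u_def v_def form_sum_left form_sum_right form_scale_left form_scale_right
        sum_distrib_left mult_ac)
  also have "\<dots> = (\<Sum>i\<in>UNIV. \<Sum>k\<in>UNIV. \<Sum>j\<in>UNIV. (cnj (m i $ k) * n j $ k) * (a i * b j * form A (n j) (m i)))"
    by (rule sum.swap)
  also have "\<dots> = (\<Sum>i\<in>UNIV. \<Sum>j\<in>UNIV. \<Sum>k\<in>UNIV. (cnj (m i $ k) * n j $ k) * (a i * b j * form A (n j) (m i)))"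
    by (rule sum.cong[OF refl], rule sum.swap)
  also have "\<dots> = (\<Sum>i\<in>UNIV. \<Sum>j\<in>UNIV. a i * joint_weight m n A i j * b j)"
    by (simp add: joint_weight_def braket_def mult_ac flip: sum_distrib_right)
      (simp add: sum_distrib_left mult_ac)
  finally have eq: "(\<Sum>i\<in>UNIV. \<Sum>j\<in>UNIV. a i * joint_weight m n A i j * b j) = (\<Sum>k\<in>UNIV. form A (v k) (u k))" ..
  have nn: "0 \<le> Re (form A w w)" for w by (rule form_nonneg[OF A])
  \<comment> \<open>Cauchy-Schwarz is applied twice: to the form for each \<open>k\<close>, then to
    the sum over \<open>k\<close>.\<close>
  have "cmod (\<Sum>k\<in>UNIV. form A (v k) (u k))
      \<le> (\<Sum>k\<in>UNIV. sqrt (Re (form A (v k) (v k))) * sqrt (Re (form A (u k) (u k))))"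
  proof (rule order_trans[OF norm_sum sum_mono])
    fix k
    show "cmod (form A (v k) (u k)) \<le> sqrt (Re (form A (v k) (v k))) * sqrt (Re (form A (u k) (u k)))"
      using form_Cauchy_Schwarz[OF A, of "v k" "u k"]
      by (metis real_le_rsqrt real_sqrt_mult)
  qed
  also have "\<dots> \<le> L2_set (\<lambda>k. sqrt (Re (form A (v k) (v k)))) UNIV * L2_set (\<lambda>k. sqrt (Re (form A (u k) (u k)))) UNIV"
    using L2_set_mult_ineq[of "\<lambda>k. sqrt (Re (form A (v k) (v k)))"
          "\<lambda>k. sqrt (Re (form A (u k) (u k)))" UNIV] nn by simp
  finally have "(cmod (\<Sum>k\<in>UNIV. form A (v k) (u k)))\<^sup>2
     \<le> (L2_set (\<lambda>k. sqrt (Re (form A (v k) (v k)))) UNIV * L2_set (\<lambda>k. sqrt (Re (form A (u k) (u k)))) UNIV)\<^sup>2"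
    by (rule power_mono) simp
  also have "\<dots> = (\<Sum>k\<in>UNIV. Re (form A (v k) (v k))) * (\<Sum>k\<in>UNIV. Re (form A (u k) (u k)))"
    using nn by (simp add: L2_set_def power_mult_distrib sum_nonneg)
  also have "\<dots> \<le> (\<Sum>j\<in>UNIV. Re (form A (cnj (b j) *s n j) (cnj (b j) *s n j)))
        * (\<Sum>i\<in>UNIV. Re (form A (a i *s m i) (a i *s m i)))"
    by (intro mult_mono form_Bessel[OF m A u_def] form_Bessel[OF n A v_def] sum_nonneg nn)
  also have "\<dots> = (\<Sum>j\<in>UNIV. (cmod (b j))\<^sup>2 * outcome_prob n A j)
        * (\<Sum>i\<in>UNIV. (cmod (a i))\<^sup>2 * outcome_prob m A i)"
  proof -
    have "Re (form A (c *s w) (c *s w)) = (cmod c)\<^sup>2 * Re (form A w w)" for c w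
      using form_nonneg(2)[OF A, of w]
      by (simp add: form_scale_left form_scale_right cmod_power2) (simp add: algebra_simps power2_eq_square)
    then show ?thesis by (simp add: outcome_prob_form)
  qed
  finally show ?thesis unfolding eq by (simp only: mult.commute)
qed

text \<open>Pairs with a vanishing probability do not enter the maximum, but their weight is zero by
  Cauchy-Schwarz; all other pairs are covered by the maximum itself.\<close>

lemma joint_weight_le_overlap:
  assumes A: "positive_semidefinite A"
  shows "cmod (joint_weight m n A i j) \<le> overlap m n A * (sqrt (outcome_prob m A i) * sqrt (outcome_prob n A j))"
proof (cases "outcome_prob m A i = 0 \<or> outcome_prob n A j = 0")
  case True
  then show ?thesis using joint_weight_eq_0[OF A True] by auto
next
  case False
  then have pos: "0 < outcome_prob m A i" "0 < outcome_prob n A j"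
    using form_nonneg(1)[OF A] by (auto simp: outcome_prob_form less_le)
  let ?f = "\<lambda>(i, j). cmod (braket (m i) (n j) * braket (n j) (A *v m i)) /
            (sqrt (outcome_prob m A i) * sqrt (outcome_prob n A j))"
  have "?f (i, j) \<le> overlap m n A"
    unfolding overlap_def
  proof (rule Max_ge)
    show "finite {cmod (braket (m i) (n j) * braket (n j) (A *v m i)) /
            (sqrt (outcome_prob m A i) * sqrt (outcome_prob n A j)) | i j.
          outcome_prob m A i \<noteq> 0 \<and> outcome_prob n A j \<noteq> 0}"
      by (rule finite_subset[of _ "range ?f"]) auto
  qed (use False in auto)
  then show ?thesis using pos by (simp add: joint_weight_def form_def field_simps)
qed

subsection \<open>The three lines theorem\<close>

text \<open>The factor \<open>exp (\<epsilon> * (z\<^sup>2 - 1))\<close> decays along the strip, so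
  the maximum modulus principle on a tall rectangle bounds the damped function by 1; then \<epsilon>
  tends to 0.\<close>

lemma three_lines_unit:
  fixes G :: "complex \<Rightarrow> complex"
  assumes hol: "G holomorphic_on UNIV"
    and bdd: "\<And>z. 0 \<le> Re z \<Longrightarrow> Re z \<le> 1 \<Longrightarrow> cmod (G z) \<le> B"
    and G0: "\<And>z. Re z = 0 \<Longrightarrow> cmod (G z) \<le> 1"
    and G1: "\<And>z. Re z = 1 \<Longrightarrow> cmod (G z) \<le> 1"
    and z: "0 \<le> Re z" "Re z \<le> 1"
  shows "cmod (G z) \<le> 1"
proof -
  have *: "cmod (G z) * exp (\<epsilon> * Re (z\<^sup>2 - 1)) \<le> 1" if \<epsilon>: "\<epsilon> > 0" for \<epsilon>
  proof -
    define H where "H w = G w * exp (of_real \<epsilon> * (w\<^sup>2 - 1))" for w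
    have H: "cmod (H w) = cmod (G w) * exp (\<epsilon> * Re (w\<^sup>2 - 1))" for w
      by (simp add: H_def norm_mult)
    \<comment> \<open>Large enough that \<open>z\<close> lies in the rectangle and that
      \<open>\<bar>B\<bar> \<le> \<epsilon> * R\<close>, whence
      \<open>exp (- (\<epsilon> * R\<^sup>2))\<close> outweighs \<open>B\<close> on the horizontal
      edges.\<close>
    define R where "R = 1 + \<bar>Im z\<bar> + \<bar>B\<bar> / \<epsilon>"
    have R: "R \<ge> 1" "\<bar>Im z\<bar> < R" using \<epsilon> unfolding R_def by (auto intro: add_pos_nonneg)
    let ?S = "cbox (Complex 0 (- R)) (Complex 1 R)"
    have damp: "Re (w\<^sup>2 - 1) \<le> - (Im w)\<^sup>2" if "0 \<le> Re w" "Re w \<le> 1" for w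
    proof -
      have "(Re w)\<^sup>2 \<le> 1" using that by (simp add: power_le_one)
      then show ?thesis by (simp add: power2_eq_square)
    qed
    have bd: "cmod (H w) \<le> 1" if w: "w \<in> frontier ?S" for w
    proof -
      have "w \<in> ?S - box (Complex 0 (- R)) (Complex 1 R)"
        using w by (simp add: frontier_def interior_cbox)
      then have strip: "0 \<le> Re w" "Re w \<le> 1"
        and edge: "Re w = 0 \<or> Re w = 1 \<or> Im w = R \<or> Im w = - R"
        by (auto simp: in_cbox_complex_iff in_box_complex_iff)
      have e: "exp (\<epsilon> * Re (w\<^sup>2 - 1)) \<le> exp (- (\<epsilon> * (Im w)\<^sup>2))"
        using mult_left_mono[OF damp[OF strip], of \<epsilon>] \<epsilon> by simp
      show ?thesis
      proof (cases "Re w = 0 \<or> Re w = 1")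
        case True
        then have "cmod (G w) \<le> 1" using G0 G1 by blast
        moreover have "exp (\<epsilon> * Re (w\<^sup>2 - 1)) \<le> 1"
          by (rule order_trans[OF e]) (use \<epsilon> in simp)
        ultimately show ?thesis unfolding H by (simp add: mult_le_one)
      next
        case False
        then have "(Im w)\<^sup>2 = R\<^sup>2" using edge by auto
        have "\<bar>B\<bar> \<le> \<epsilon> * R" using \<epsilon> by (simp add: R_def field_simps)
        also have "\<dots> \<le> \<epsilon> * R\<^sup>2" using \<epsilon> R(1) by (simp add: power2_eq_square)
        also have "\<dots> \<le> exp (\<epsilon> * R\<^sup>2)" using exp_ge_add_one_self[of "\<epsilon> * R\<^sup>2"] by linarith
        finally have "B * exp (- (\<epsilon> * R\<^sup>2)) \<le> 1"
          by (simp add: exp_minus field_simps)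
        moreover have "cmod (H w) \<le> B * exp (- (\<epsilon> * R\<^sup>2))"
          unfolding H using e bdd[OF strip] \<open>(Im w)\<^sup>2 = R\<^sup>2\<close>
          by (intro mult_mono) (auto intro: order_trans[OF norm_ge_zero])
        ultimately show ?thesis by linarith
      qed
    qed
    have holH: "H holomorphic_on UNIV" unfolding H_def using hol by (intro holomorphic_intros)
    have "cmod (H z) \<le> 1"
    proof (rule maximum_modulus_frontier[where f = H and S = ?S])
      show "H holomorphic_on interior ?S" using holH by (rule holomorphic_on_subset) simp
      show "continuous_on (closure ?S) H"
        using holomorphic_on_imp_continuous_on[OF holH] by (rule continuous_on_subset) simp
      show "z \<in> ?S" using z R by (auto simp: in_cbox_complex_iff)
    qed (use bd in auto)
    then show ?thesis by (simp add: H)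
  qed
  have "((\<lambda>\<epsilon>. cmod (G z) * exp (\<epsilon> * Re (z\<^sup>2 - 1))) \<longlongrightarrow> cmod (G z) * exp (0 * Re (z\<^sup>2 - 1))) (at_right 0)"
    by (intro tendsto_intros)
  then have "cmod (G z) * exp (0 * Re (z\<^sup>2 - 1)) \<le> 1"
    by (rule tendsto_upperbound) (auto simp: eventually_at_filter simp del: minus_complex.sel intro!: always_eventually *)
  then show ?thesis by simp
qed

text \<open>Dividing \<open>F\<close> by the zero-free entire function
  \<open>M0 powr (1 - z) * M1 powr z\<close>, here written with \<open>exp\<close>, reduces both
  boundary bounds to 1.\<close>

lemma Hadamard_three_lines:
  fixes F :: "complex \<Rightarrow> complex"
  assumes hol: "F holomorphic_on UNIV"
    and bdd: "\<And>z. 0 \<le> Re z \<Longrightarrow> Re z \<le> 1 \<Longrightarrow> cmod (F z) \<le> B"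
    and F0: "\<And>z. Re z = 0 \<Longrightarrow> cmod (F z) \<le> M0"
    and F1: "\<And>z. Re z = 1 \<Longrightarrow> cmod (F z) \<le> M1"
    and M: "M0 > 0" "M1 > 0"
    and z: "0 \<le> Re z" "Re z \<le> 1"
  shows "cmod (F z) \<le> M0 powr (1 - Re z) * M1 powr Re z"
proof -
  define c where "c w = (w - 1) * of_real (ln M0) - w * of_real (ln M1)" for w :: complex
  define G where "G w = F w * exp (c w)" for w
  have G: "cmod (G w) = cmod (F w) * (exp ((Re w - 1) * ln M0) * exp (- Re w * ln M1))" for w
    by (simp add: G_def c_def norm_mult algebra_simps flip: exp_add)
  have "cmod (G z) \<le> 1"
  proof (rule three_lines_unit[where G = G and B = "B * (exp \<bar>ln M0\<bar> * exp \<bar>ln M1\<bar>)"])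
    show "G holomorphic_on UNIV" unfolding G_def c_def using hol by (intro holomorphic_intros)
    show "cmod (G w) \<le> B * (exp \<bar>ln M0\<bar> * exp \<bar>ln M1\<bar>)" if w: "0 \<le> Re w" "Re w \<le> 1" for w
    proof -
      have le_abs: "s * t \<le> \<bar>t\<bar>" if "\<bar>s\<bar> \<le> 1" for s t :: real
      proof -
        have "s * t \<le> \<bar>s\<bar> * \<bar>t\<bar>" by (metis abs_ge_self abs_mult)
        also have "\<dots> \<le> 1 * \<bar>t\<bar>" using that by (intro mult_right_mono) auto
        finally show ?thesis by simp
      qed
      have "(Re w - 1) * ln M0 \<le> \<bar>ln M0\<bar>" "- Re w * ln M1 \<le> \<bar>ln M1\<bar>"
        by (rule le_abs, use w in simp)+
      then show ?thesis
        unfolding G using bdd[OF w] by (intro mult_mono) (auto intro: order_trans[OF norm_ge_zero])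
    qed
    show "cmod (G w) \<le> 1" if "Re w = 0" for w
      using F0[OF that] M by (simp add: G that exp_minus field_simps)
    show "cmod (G w) \<le> 1" if "Re w = 1" for w
      using F1[OF that] M by (simp add: G that exp_minus field_simps)
  qed (use z in auto)
  moreover have "cmod (F z) = cmod (G z) * (M0 powr (1 - Re z) * M1 powr Re z)"
  proof -
    have "exp ((Re z - 1) * ln M0) * exp (- Re z * ln M1) * (M0 powr (1 - Re z) * M1 powr Re z) = 1"
      using M by (simp add: powr_def algebra_simps flip: exp_add)
    then show ?thesis unfolding G by (simp add: mult.assoc)
  qed
  ultimately show ?thesis
    using mult_right_mono[of "cmod (G z)" 1 "M0 powr (1 - Re z) * M1 powr Re z"] by simp
qed

subsection \<open>Entropies of the two marginals\<close>

text \<open>The formula for \<beta> is the relation 1 / \<alpha> + 1 / \<beta> = 2 solved for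
  \<beta>.\<close>

lemma one_minus_conjugate:
  fixes \<alpha> \<beta> :: real
  assumes "1 < \<alpha>" and "\<beta> = \<alpha> / (2 * \<alpha> - 1)"
  shows "1 - \<beta> = (\<alpha> - 1) / (2 * \<alpha> - 1)"
  using assms by (simp add: divide_simps) (simp add: algebra_simps)

lemma conjugate_less_1:
  fixes \<alpha> \<beta> :: real
  assumes "1 < \<alpha>" and "\<beta> = \<alpha> / (2 * \<alpha> - 1)"
  shows "\<beta> < 1"
  using assms by simp

text \<open>What the interpolation uses of the measurements and the state: \<open>S\<close> is a
  complex coupling of \<open>p\<close> and \<open>q\<close> with an L2 bound and an entrywise bound.
  The conditions are symmetric in the two distributions.\<close>

locale correlated_distributions =
  fixes p :: "'i::finite \<Rightarrow> real" and q :: "'j::finite \<Rightarrow> real"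
    and S :: "'i \<Rightarrow> 'j \<Rightarrow> complex" and g :: real
  assumes p_nonneg: "\<And>i. 0 \<le> p i" and q_nonneg: "\<And>j. 0 \<le> q j"
    and p_sum: "(\<Sum>i\<in>UNIV. p i) = 1" and q_sum: "(\<Sum>j\<in>UNIV. q j) = 1"
    and marginal1: "\<And>i. (\<Sum>j\<in>UNIV. S i j) = of_real (p i)"
    and marginal2: "\<And>j. (\<Sum>i\<in>UNIV. S i j) = of_real (q j)"
    and bilinear_bound: "\<And>a b. (cmod (\<Sum>i\<in>UNIV. \<Sum>j\<in>UNIV. a i * S i j * b j))\<^sup>2
      \<le> (\<Sum>i\<in>UNIV. (cmod (a i))\<^sup>2 * p i) * (\<Sum>j\<in>UNIV. (cmod (b j))\<^sup>2 * q j)"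
    and entry_bound: "\<And>i j. cmod (S i j) \<le> g * (sqrt (p i) * sqrt (q j))"
begin

text \<open>Carries every fact about \<open>p\<close> over to \<open>q\<close>, and the results for
  \<alpha> > 1 over to \<alpha> < 1.\<close>

lemma transposed: "correlated_distributions q p (\<lambda>j i. S i j) g"
proof
  show "(cmod (\<Sum>i\<in>UNIV. \<Sum>j\<in>UNIV. a i * S j i * b j))\<^sup>2
      \<le> (\<Sum>i\<in>UNIV. (cmod (a i))\<^sup>2 * q i) * (\<Sum>j\<in>UNIV. (cmod (b j))\<^sup>2 * p j)" for a b
    using bilinear_bound[of b a] by (subst sum.swap) (simp add: mult_ac)
  show "cmod (S j i) \<le> g * (sqrt (q i) * sqrt (p j))" for i j
    using entry_bound[of j i] by (simp add: mult_ac)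
qed (fact p_nonneg q_nonneg p_sum q_sum marginal1 marginal2)+

text \<open>Otherwise the entrywise bound makes \<open>S\<close> vanish, and with it the marginal
  \<open>p\<close>, whose sum is 1.\<close>

lemma g_pos: "0 < g"
proof (rule ccontr)
  assume "\<not> 0 < g"
  have "S i j = 0" for i j
  proof -
    have "cmod (S i j) \<le> 0"
      using \<open>\<not> 0 < g\<close> p_nonneg[of i] q_nonneg[of j]
      by (intro order_trans[OF entry_bound] mult_nonpos_nonneg) auto
    then show ?thesis by simp
  qed
  then have "p i = 0" for i using marginal1[of i] by simp
  then show False using p_sum by simp
qed

lemma p_le_1: "p i \<le> 1"
  using member_le_sum[of i UNIV p] p_nonneg p_sum by simp

lemma powr_sum_pos: "0 < (\<Sum>i\<in>UNIV. p i powr t)"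
proof -
  have "(\<Sum>i\<in>UNIV. p i) \<noteq> 0" by (simp add: p_sum)
  then obtain i where "p i \<noteq> 0" by (meson sum.not_neutral_contains_not_neutral)
  then have "0 < p i" using p_nonneg[of i] by simp
  then show ?thesis by (intro sum_pos2[of _ i]) auto
qed

lemma powr_sum_le_1: "(\<Sum>i\<in>UNIV. p i powr t) \<le> 1" if "t \<ge> 1"
proof -
  have "p i powr t \<le> p i" for i
    using powr_mono'[of 1 t "p i"] that p_nonneg[of i] p_le_1[of i] by simp
  then show ?thesis using sum_mono[of UNIV "\<lambda>i. p i powr t" p] p_sum by simp
qed

lemma powr_sum_ge_1: "1 \<le> (\<Sum>i\<in>UNIV. p i powr t)" if "t \<le> 1"
proof -
  have "p i \<le> p i powr t" for i
    using powr_mono'[of t 1 "p i"] that p_nonneg[of i] p_le_1[of i] by simp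
  then show ?thesis using sum_mono[of UNIV p "\<lambda>i. p i powr t"] p_sum by simp
qed

text \<open>
  Riesz--Thorin interpolation between the bilinear bound on \<open>Re z = 0\<close> and the entrywise bound on
  \<open>Re z = 1\<close>; the exponents are chosen so that at \<open>z = 1 - 1 / \<alpha>\<close> the weights of \<open>q\<close> disappear
  and the bilinear sum collapses to the sum of the powers \<open>p i powr \<alpha>\<close>.
\<close>

lemma ln_powr_sum_le:
  assumes \<alpha>: "1 < \<alpha>"
  shows "ln (\<Sum>i\<in>UNIV. p i powr \<alpha>)
    \<le> (2 * \<alpha> - 1) * ln (\<Sum>j\<in>UNIV. q j powr (\<alpha> / (2 * \<alpha> - 1))) + 2 * (\<alpha> - 1) * ln g"
proof -
  define \<beta> where "\<beta> = \<alpha> / (2 * \<alpha> - 1)"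
  define P where "P = (\<Sum>i\<in>UNIV. p i powr \<alpha>)"
  define Q where "Q = (\<Sum>j\<in>UNIV. q j powr \<beta>)"
  define \<theta> where "\<theta> = 1 - 1 / \<alpha>"
  have \<beta>: "0 < \<beta>" and \<theta>: "0 < \<theta>" "\<theta> < 1" using \<alpha> by (auto simp: \<beta>_def \<theta>_def)
  have PQ: "0 < P" "0 < Q"
    unfolding P_def Q_def
    by (rule powr_sum_pos, rule correlated_distributions.powr_sum_pos[OF transposed])
  \<comment> \<open>For positive \<open>x\<close> this is the power of \<open>x\<close> with
    exponent \<gamma> (1 + z) / 2 - 1 / 2. The -1 / 2 absorbs the square roots in the bounds on
    \<open>S\<close>; at \<open>x = 0\<close> the value does not matter, as it meets a factor
    0.\<close>
  define w where "w \<gamma> z x = exp (of_real (ln x) * (of_real \<gamma> * (1 + z) / 2 - 1 / 2))"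
    for \<gamma> x :: real and z :: complex
  have w1: "cmod (w \<gamma> z x) * sqrt x = x powr (\<gamma> * (1 + Re z) / 2)" if "0 \<le> x" for \<gamma> x z
  proof (cases "x = 0")
    case False
    then have "sqrt x = exp (ln x / 2)" using that by (metis less_eq_real_def ln_sqrt exp_ln real_sqrt_gt_zero)
    then show ?thesis using False that
      by (simp add: w_def powr_def algebra_simps add_divide_distrib flip: exp_add)
  qed simp
  have w2: "(cmod (w \<gamma> z x))\<^sup>2 * x = x powr (\<gamma> * (1 + Re z))" if "0 \<le> x" for \<gamma> x z
  proof -
    have "(cmod (w \<gamma> z x))\<^sup>2 * x = (cmod (w \<gamma> z x) * sqrt x)\<^sup>2" using that by (simp add: power_mult_distrib)
    also have "\<dots> = x powr (\<gamma> * (1 + Re z))" unfolding w1[OF that]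
      by (simp add: power2_eq_square flip: powr_add)
    finally show ?thesis .
  qed
  define F where "F z = (\<Sum>i\<in>UNIV. \<Sum>j\<in>UNIV. w \<alpha> z (p i) * S i j * w \<beta> z (q j))" for z
  have F_le: "cmod (F z) \<le> (\<Sum>i\<in>UNIV. \<Sum>j\<in>UNIV. g * (p i powr (\<alpha> * (1 + Re z) / 2) * q j powr (\<beta> * (1 + Re z) / 2)))"
    for z
    unfolding F_def
  proof (intro sum_norm_le)
    fix i j
    have "cmod (w \<alpha> z (p i) * S i j * w \<beta> z (q j))
        \<le> cmod (w \<alpha> z (p i)) * (g * (sqrt (p i) * sqrt (q j))) * cmod (w \<beta> z (q j))"
      unfolding norm_mult by (intro mult_left_mono mult_right_mono entry_bound) auto
    also have "\<dots> = g * ((cmod (w \<alpha> z (p i)) * sqrt (p i)) * (cmod (w \<beta> z (q j)) * sqrt (q j)))"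
      by (simp add: mult_ac)
    finally show "cmod (w \<alpha> z (p i) * S i j * w \<beta> z (q j))
        \<le> g * (p i powr (\<alpha> * (1 + Re z) / 2) * q j powr (\<beta> * (1 + Re z) / 2))"
      by (simp add: w1 p_nonneg q_nonneg)
  qed
  \<comment> \<open>On Re z = 0 the squared weights turn the bilinear bound into
    \<open>sqrt (P * Q)\<close>; on Re z = 1 the powers in \<open>F_le\<close> have exponents
    \<alpha> and \<beta>, which gives \<open>g * P * Q\<close>.\<close>
  have "cmod (F (of_real \<theta>)) \<le> sqrt (P * Q) powr (1 - Re (of_real \<theta>)) * (g * P * Q) powr Re (of_real \<theta>)"
  proof (rule Hadamard_three_lines[where F = F and B = "\<Sum>i\<in>(UNIV::'i set). \<Sum>j\<in>(UNIV::'j set). g"])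
    show "F holomorphic_on UNIV" unfolding F_def w_def by (intro holomorphic_intros) auto
    show "cmod (F z) \<le> (\<Sum>i\<in>(UNIV::'i set). \<Sum>j\<in>(UNIV::'j set). g)" if "0 \<le> Re z" "Re z \<le> 1" for z
    proof (rule order_trans[OF F_le], intro sum_mono)
      fix i j
      have "p i powr (\<alpha> * (1 + Re z) / 2) \<le> 1" "q j powr (\<beta> * (1 + Re z) / 2) \<le> 1"
        using that \<alpha> \<beta> p_nonneg q_nonneg p_le_1 correlated_distributions.p_le_1[OF transposed]
        by (auto intro!: powr_le1)
      then have "p i powr (\<alpha> * (1 + Re z) / 2) * q j powr (\<beta> * (1 + Re z) / 2) \<le> 1"
        by (intro mult_le_one) auto
      then show "g * (p i powr (\<alpha> * (1 + Re z) / 2) * q j powr (\<beta> * (1 + Re z) / 2)) \<le> g"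
        using g_pos by simp
    qed
    show "cmod (F z) \<le> sqrt (P * Q)" if "Re z = 0" for z
      by (rule real_le_rsqrt)
        (use bilinear_bound[of "\<lambda>i. w \<alpha> z (p i)" "\<lambda>j. w \<beta> z (q j)"] that in
          \<open>simp add: F_def w2 p_nonneg q_nonneg P_def Q_def\<close>)
    show "cmod (F z) \<le> g * P * Q" if "Re z = 1" for z
      using F_le[of z] that by (simp add: P_def Q_def sum_product mult.assoc flip: sum_distrib_left)
  qed (use g_pos PQ \<theta> in auto)
  moreover have "F (of_real \<theta>) = of_real P"
  proof -
    \<comment> \<open>Here 1 + \<theta> = 1 / \<beta>, so the \<open>q\<close> weight becomes 1; the
      \<open>p\<close> weight has exponent \<alpha> - 1, and the row sums of \<open>S\<close> supply
      the missing factor \<open>p i\<close>.\<close>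
    have "\<beta> * (1 + \<theta>) / 2 - 1 / 2 = 0" "\<alpha> * (1 + \<theta>) / 2 - 1 / 2 = \<alpha> - 1"
      using \<alpha> by (simp_all add: \<beta>_def \<theta>_def field_simps)
    then have exps: "of_real \<beta> * (1 + of_real \<theta>) / 2 - 1 / 2 = (of_real 0 :: complex)"
      "of_real \<alpha> * (1 + of_real \<theta>) / 2 - 1 / 2 = (of_real (\<alpha> - 1) :: complex)"
      by (simp_all add: complex_eq_iff)
    have wq: "w \<beta> (of_real \<theta>) (q j) = 1" for j unfolding w_def exps by simp
    have "w \<alpha> (of_real \<theta>) (p i) * of_real (p i) = of_real (p i powr \<alpha>)" for i
    proof -
      have "w \<alpha> (of_real \<theta>) (p i) = of_real (exp (ln (p i) * (\<alpha> - 1)))"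
        unfolding w_def exps by (simp only: exp_of_real of_real_mult[symmetric])
      moreover have "exp (ln (p i) * (\<alpha> - 1)) * p i = p i powr \<alpha>"
        using p_nonneg[of i] by (cases "p i = 0") (simp_all add: powr_def algebra_simps exp_diff)
      ultimately show ?thesis by (metis of_real_mult)
    qed
    then show ?thesis
      by (simp add: F_def wq P_def marginal1 flip: sum_distrib_left)
  qed
  ultimately have "P \<le> sqrt (P * Q) powr (1 - \<theta>) * (g * P * Q) powr \<theta>"
    using PQ by simp
  then have "ln P \<le> ln (sqrt (P * Q) powr (1 - \<theta>) * (g * P * Q) powr \<theta>)"
    using PQ by simp
  also have "\<dots> = (1 - \<theta>) * ((ln P + ln Q) / 2) + \<theta> * (ln g + ln P + ln Q)"
    using PQ g_pos by (simp add: ln_mult ln_powr ln_sqrt)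
  \<comment> \<open>The factor 2 \<alpha> clears denominators, as \<alpha> (1 - \<theta>) = 1 and
    \<alpha> \<theta> = \<alpha> - 1. The right side then contains \<open>ln P\<close> 2 \<alpha> -
    1 times, so a single \<open>ln P\<close> is left on the left.\<close>
  finally have "2 * \<alpha> * ln P \<le> 2 * \<alpha> * ((1 - \<theta>) * ((ln P + ln Q) / 2) + \<theta> * (ln g + ln P + ln Q))"
    using \<alpha> by (intro mult_left_mono) auto
  also have "\<dots> = (\<alpha> * (1 - \<theta>)) * (ln P + ln Q) + 2 * (\<alpha> * \<theta>) * (ln g + ln P + ln Q)"
    by (simp add: field_simps)
  also have "\<dots> = (ln P + ln Q) + 2 * (\<alpha> - 1) * (ln g + ln P + ln Q)"
    using \<alpha> by (simp add: \<theta>_def field_simps)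
  finally show ?thesis
    unfolding P_def[symmetric] Q_def[symmetric] \<beta>_def[symmetric] by (simp add: algebra_simps)
qed

section \<open>Renyi and Tsallis entropies, and the inequalities for \<alpha> > 1\<close>

lemma renyi_eq: "renyi_entropy t p = 1 / (1 - t) * ln (\<Sum>i\<in>UNIV. p i powr t)" if "t \<noteq> 1"
proof -
  have "(\<Sum>j | p j > 0. p j powr t) = (\<Sum>i\<in>UNIV. p i powr t)"
    by (rule sum.mono_neutral_left) (use p_nonneg in \<open>auto simp: not_less intro: antisym\<close>)
  then show ?thesis using that by (simp add: renyi_entropy_def)
qed

lemma tsallis_eq: "tsallis_entropy t p = 1 / (1 - t) * ((\<Sum>i\<in>UNIV. p i powr t) - 1)" if "t \<noteq> 1"
proof -
  have "(\<Sum>j | p j > 0. p j powr t) = (\<Sum>i\<in>UNIV. p i powr t)"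
    by (rule sum.mono_neutral_left) (use p_nonneg in \<open>auto simp: not_less intro: antisym\<close>)
  then show ?thesis using that by (simp add: tsallis_entropy_def)
qed

text \<open>The logarithm of the power sum and the prefactor 1 / (1 - t) change sign together at t =
  1.\<close>

lemma renyi_nonneg: "0 \<le> renyi_entropy t p" if "t \<noteq> 1"
proof (cases "t > 1")
  case True
  then have "ln (\<Sum>i\<in>UNIV. p i powr t) \<le> 0"
    using powr_sum_le_1[of t] powr_sum_pos[of t] by simp
  then show ?thesis using True by (simp add: renyi_eq divide_nonpos_nonpos)
next
  case False
  then have "0 \<le> ln (\<Sum>i\<in>UNIV. p i powr t)" using powr_sum_ge_1[of t] by simp
  then show ?thesis using False that by (simp add: renyi_eq)
qed

lemma tsallis_eq_renyi:
  "tsallis_entropy t p = (1 - exp (- (t - 1) * renyi_entropy t p)) / (t - 1)" if "t \<noteq> 1"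
proof -
  have "- (t - 1) * renyi_entropy t p = ln (\<Sum>i\<in>UNIV. p i powr t)"
    using that by (simp add: renyi_eq field_simps)
  then have "exp (- (t - 1) * renyi_entropy t p) = (\<Sum>i\<in>UNIV. p i powr t)"
    using powr_sum_pos[of t] by simp
  then show ?thesis using that by (simp add: tsallis_eq field_simps)
qed

text \<open>This is exp x \<ge> 1 + x at x = \<open>(1 - t) * renyi_entropy t p\<close>, divided by
  the positive number 1 - t.\<close>

lemma tsallis_ge_renyi: "renyi_entropy t p \<le> tsallis_entropy t p" if "t < 1"
proof -
  have "(1 - t) * renyi_entropy t p \<le> exp ((1 - t) * renyi_entropy t p) - 1"
    using exp_ge_add_one_self[of "(1 - t) * renyi_entropy t p"] by linarith
  also have "\<dots> = (1 - t) * tsallis_entropy t p"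
    using that by (simp add: tsallis_eq_renyi field_simps)
  finally show ?thesis using that by simp
qed

text \<open>Divide the logarithmic inequality by \<alpha> - 1; the coefficient of the
  \<open>q\<close> term becomes exactly 1 / (1 - \<beta>).\<close>

lemma renyi_uncertainty_gt_1:
  assumes "1 < \<alpha>" and "\<beta> = \<alpha> / (2 * \<alpha> - 1)"
  shows "renyi_entropy \<alpha> p + renyi_entropy \<beta> q \<ge> - 2 * ln g"
proof -
  let ?P = "\<Sum>i\<in>UNIV. p i powr \<alpha>" and ?Q = "\<Sum>j\<in>UNIV. q j powr \<beta>"
  have "\<beta> \<noteq> 1" and \<beta>: "1 / (1 - \<beta>) = (2 * \<alpha> - 1) / (\<alpha> - 1)"
    using one_minus_conjugate[OF assms] assms(1) by auto
  have "ln ?P \<le> (2 * \<alpha> - 1) * ln ?Q + 2 * (\<alpha> - 1) * ln g"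
    using ln_powr_sum_le[OF assms(1)] assms(2) by simp
  then have "- 2 * ln g * (\<alpha> - 1) \<le> - ln ?P + (2 * \<alpha> - 1) * ln ?Q"
    by (simp add: algebra_simps)
  then have "- 2 * ln g \<le> (- ln ?P + (2 * \<alpha> - 1) * ln ?Q) / (\<alpha> - 1)"
    using assms(1) by (simp add: pos_le_divide_eq)
  also have "\<dots> = 1 / (1 - \<alpha>) * ln ?P + (2 * \<alpha> - 1) / (\<alpha> - 1) * ln ?Q"
    using assms(1) by (simp add: divide_simps) (simp add: algebra_simps)
  finally show ?thesis
    using assms(1)
    by (simp add: \<beta> renyi_eq correlated_distributions.renyi_eq[OF transposed \<open>\<beta> \<noteq> 1\<close>])
qed

text \<open>
  With \<open>c = \<alpha> - 1\<close>, the function \<open>t \<mapsto> (1 - exp (- c t)) / c\<close> is increasing, subadditive on the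
  nonnegative reals and at most \<open>t\<close>, and it turns Renyi into Tsallis entropies of order \<open>\<alpha>\<close>.
\<close>

lemma tsallis_uncertainty_gt_1:
  assumes "1 < \<alpha>" and "\<beta> = \<alpha> / (2 * \<alpha> - 1)"
  shows "tsallis_entropy \<alpha> p + tsallis_entropy \<beta> q \<ge> tsallis_ln \<alpha> (g powi (-2))"
proof -
  define f where "f t = (1 - exp (- (\<alpha> - 1) * t)) / (\<alpha> - 1)" for t
  define r where "r = renyi_entropy \<alpha> p"
  define s where "s = renyi_entropy \<beta> q"
  have \<beta>: "\<beta> < 1" using assms by (rule conjugate_less_1)
  have rs: "0 \<le> r" "0 \<le> s"
    unfolding r_def s_def using assms(1) \<beta>
    by (auto intro!: renyi_nonneg correlated_distributions.renyi_nonneg[OF transposed])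
  have "tsallis_ln \<alpha> (g powi (-2)) = f (- 2 * ln g)"
  proof -
    have "ln (g powi (-2)) = - 2 * ln g"
      using g_pos by (simp add: power_int_minus ln_inverse ln_realpow)
    then have "(g powi (-2)) powr (1 - \<alpha>) = exp (- (\<alpha> - 1) * (- 2 * ln g))"
      using g_pos by (simp add: powr_def)
    then show ?thesis using assms(1) by (simp add: tsallis_ln_def f_def divide_simps) (simp add: algebra_simps)
  qed
  also have "\<dots> \<le> f (r + s)"
  proof -
    have "- (\<alpha> - 1) * (r + s) \<le> - (\<alpha> - 1) * (- 2 * ln g)"
      using renyi_uncertainty_gt_1[OF assms] assms(1) by (intro mult_left_mono_neg) (auto simp: r_def s_def)
    then show ?thesis using assms(1) unfolding f_def by (intro divide_right_mono) auto
  qed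
  also have "\<dots> \<le> f r + f s"
  proof -
    \<comment> \<open>Subadditivity: (1 - x) (1 - y) \<ge> 0 rearranges to 1 - x y \<le> (1 - x) +
      (1 - y).\<close>
    have "0 \<le> (1 - exp (- (\<alpha> - 1) * r)) * (1 - exp (- (\<alpha> - 1) * s))"
      using assms(1) rs by (intro mult_nonneg_nonneg) (auto simp: mult_nonpos_nonneg)
    moreover have "exp (- (\<alpha> - 1) * (r + s)) = exp (- (\<alpha> - 1) * r) * exp (- (\<alpha> - 1) * s)"
      by (simp add: algebra_simps flip: exp_add)
    ultimately show ?thesis
      using assms(1) unfolding f_def add_divide_distrib[symmetric]
      by (intro divide_right_mono) (auto simp: algebra_simps)
  qed
  \<comment> \<open>\<open>f\<close> belongs to order \<alpha>, so the order \<beta> term is passed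
    on through its Renyi value, which its Tsallis value dominates because \<beta> < 1.\<close>
  also have "f s \<le> s"
    using exp_ge_add_one_self[of "- (\<alpha> - 1) * s"] assms(1) by (simp add: f_def pos_divide_le_eq algebra_simps)
  also have "s \<le> tsallis_entropy \<beta> q"
    unfolding s_def by (rule correlated_distributions.tsallis_ge_renyi[OF transposed \<beta>])
  also have "f r = tsallis_entropy \<alpha> p"
    using assms(1) by (simp add: tsallis_eq_renyi f_def r_def)
  finally show ?thesis by simp
qed

section \<open>The Shannon case and the symmetric statement\<close>

lemma powr_sum_deriv:
  "((\<lambda>t. \<Sum>i\<in>UNIV. p i powr t) has_real_derivative - shannon_entropy p) (at 1)"
proof -
  have eq: "(\<lambda>t. \<Sum>i\<in>UNIV. p i powr t) = (\<lambda>t. \<Sum>i | p i > 0. exp (t * ln (p i)))"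
  proof
    fix t
    have "(\<Sum>i\<in>UNIV. p i powr t) = (\<Sum>i | p i > 0. p i powr t)"
      by (rule sum.mono_neutral_right) (use p_nonneg in \<open>auto simp: not_less intro: antisym\<close>)
    then show "(\<Sum>i\<in>UNIV. p i powr t) = (\<Sum>i | p i > 0. exp (t * ln (p i)))"
      by (simp add: powr_def)
  qed
  show ?thesis unfolding eq shannon_entropy_def
    by (auto intro!: derivative_eq_intros sum.cong)
qed

text \<open>For h > 0 the interpolation inequality says
  \<open>D (1 + h) \<ge> - 2 * ln g * h\<close>, while \<open>D 1 = 0\<close>. Hence the derivative
  of \<open>D\<close> at 1, the sum of the two Shannon entropies, is at least
  \<open>- 2 * ln g\<close>.\<close>

lemma shannon_uncertainty: "shannon_entropy p + shannon_entropy q \<ge> - 2 * ln g"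
proof -
  define D where "D \<alpha> = (2 * \<alpha> - 1) * ln (\<Sum>j\<in>UNIV. q j powr (\<alpha> / (2 * \<alpha> - 1)))
      - ln (\<Sum>i\<in>UNIV. p i powr \<alpha>)" for \<alpha>
  have p1: "(\<Sum>i\<in>UNIV. p i powr 1) = 1" and q1: "(\<Sum>j\<in>UNIV. q j powr 1) = 1"
    using p_nonneg q_nonneg p_sum q_sum by simp_all
  have \<beta>: "((\<lambda>\<alpha>::real. \<alpha> / (2 * \<alpha> - 1)) has_real_derivative -1) (at 1)"
    by (auto intro!: derivative_eq_intros)
  have "((\<lambda>t. \<Sum>j\<in>UNIV. q j powr t) has_real_derivative - shannon_entropy q) (at (1 / (2 * 1 - 1)))"
    using correlated_distributions.powr_sum_deriv[OF transposed] by simp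
  from DERIV_chain2[OF this \<beta>]
  have Q: "((\<lambda>\<alpha>. \<Sum>j\<in>UNIV. q j powr (\<alpha> / (2 * \<alpha> - 1))) has_real_derivative shannon_entropy q) (at 1)"
    by simp
  have lnQ: "((\<lambda>\<alpha>. ln (\<Sum>j\<in>UNIV. q j powr (\<alpha> / (2 * \<alpha> - 1)))) has_real_derivative shannon_entropy q) (at 1)"
    using DERIV_chain2[OF DERIV_ln Q] q1 by simp
  have lnP: "((\<lambda>\<alpha>. ln (\<Sum>i\<in>UNIV. p i powr \<alpha>)) has_real_derivative - shannon_entropy p) (at 1)"
    using DERIV_chain2[OF DERIV_ln powr_sum_deriv] p1 by simp
  \<comment> \<open>Differentiating the factor 2 \<alpha> - 1 contributes nothing, since the
    logarithm of the \<open>q\<close> sum is 0 at \<alpha> = 1.\<close>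
  have "(D has_real_derivative shannon_entropy p + shannon_entropy q) (at 1)"
    unfolding D_def by (rule derivative_eq_intros lnP lnQ refl)+ (use q1 in simp)
  then have "((\<lambda>h. (D (1 + h) - D 1) / h) \<longlongrightarrow> shannon_entropy p + shannon_entropy q) (at_right 0)"
    by (rule filterlim_mono[OF DERIV_D]) (auto simp: at_le)
  moreover have "\<forall>\<^sub>F h in at_right 0. - 2 * ln g \<le> (D (1 + h) - D 1) / h"
  proof (rule eventually_at_right_less[THEN eventually_mono])
    fix h :: real assume h: "0 < h"
    have "D 1 = 0" using p1 q1 by (simp add: D_def)
    moreover have "- 2 * ln g * h \<le> D (1 + h)"
      using ln_powr_sum_le[of "1 + h"] h by (simp add: D_def algebra_simps)
    ultimately show "- 2 * ln g \<le> (D (1 + h) - D 1) / h" using h by (simp add: pos_le_divide_eq)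
  qed
  ultimately show ?thesis by (rule tendsto_lowerbound) simp
qed

text \<open>Either both orders are 1 or exactly one exceeds 1. That one is \<mu>, and exchanging the
  distributions if necessary makes it the order of the first.\<close>

lemma entropic_uncertainty:
  assumes "\<alpha> > 0" "\<beta> > 0" "1 / \<alpha> + 1 / \<beta> = 2" "\<mu> = max \<alpha> \<beta>"
  shows "tsallis_entropy \<alpha> p + tsallis_entropy \<beta> q \<ge> tsallis_ln \<mu> (g powi (-2))
    \<and> renyi_entropy \<alpha> p + renyi_entropy \<beta> q \<ge> - 2 * ln g"
proof -
  have eq: "\<alpha> + \<beta> = 2 * \<alpha> * \<beta>" using assms(1-3) by (simp add: field_simps)
  have conj: "y = x / (2 * x - 1)" if "1 < x" "x + y = 2 * x * y" for x y :: real
    using that by (simp add: field_simps)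
  consider "\<alpha> = 1" | "1 < \<alpha>" | "\<alpha> < 1" by linarith
  then show ?thesis
  proof cases
    case 1
    have "\<beta> = 1" using eq 1 by simp
    moreover have "ln (g powi (-2)) = - 2 * ln g"
      using g_pos by (simp add: power_int_minus ln_inverse ln_realpow)
    ultimately show ?thesis
      using shannon_uncertainty 1 assms(4)
      by (simp add: tsallis_entropy_def renyi_entropy_def tsallis_ln_def)
  next
    case 2
    have \<beta>: "\<beta> = \<alpha> / (2 * \<alpha> - 1)" by (rule conj[OF 2 eq])
    have "\<mu> = \<alpha>" using conjugate_less_1[OF 2 \<beta>] 2 assms(4) by simp
    then show ?thesis
      using tsallis_uncertainty_gt_1[OF 2 \<beta>] renyi_uncertainty_gt_1[OF 2 \<beta>] by blast
  next
    case 3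
    have \<beta>: "1 < \<beta>"
    proof -
      have "1 / \<alpha> > 1" using 3 assms(1) by simp
      then have "1 / \<beta> < 1" using assms(3) by linarith
      then show ?thesis using assms(2) by (simp add: field_simps)
    qed
    have \<alpha>: "\<alpha> = \<beta> / (2 * \<beta> - 1)" by (rule conj[OF \<beta>]) (use eq in \<open>simp add: mult_ac add_ac\<close>)
    have "\<mu> = \<beta>" using 3 \<beta> assms(4) by simp
    then show ?thesis
      using correlated_distributions.tsallis_uncertainty_gt_1[OF transposed \<beta> \<alpha>]
        correlated_distributions.renyi_uncertainty_gt_1[OF transposed \<beta> \<alpha>]
      by (simp add: add.commute)
  qed
qed

end

subsection \<open>The uncertainty relation\<close>

theorem proposition9:
  fixes m :: "'i::finite \<Rightarrow> complex ^ 'd"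
    and n :: "'j::finite \<Rightarrow> complex ^ 'd"
    and \<rho> :: "complex ^ 'd ^ 'd"
    and \<alpha> \<beta> \<mu> :: real
  assumes "rank_one_povm m"
    and "rank_one_povm n"
    and "density_matrix \<rho>"
    and "\<alpha> > 0"
    and "\<beta> > 0"
    and "1 / \<alpha> + 1 / \<beta> = 2"
    and "\<mu> = max \<alpha> \<beta>"
  shows "tsallis_entropy \<alpha> (outcome_prob m \<rho>) + tsallis_entropy \<beta> (outcome_prob n \<rho>)
           \<ge> tsallis_ln \<mu> (overlap m n \<rho> powi (-2))
       \<and> renyi_entropy \<alpha> (outcome_prob m \<rho>) + renyi_entropy \<beta> (outcome_prob n \<rho>)
           \<ge> - 2 * ln (overlap m n \<rho>)"
proof -
  have psd: "positive_semidefinite \<rho>" using assms(3) by (simp add: density_matrix_def)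
  interpret correlated_distributions "outcome_prob m \<rho>" "outcome_prob n \<rho>"
    "joint_weight m n \<rho>" "overlap m n \<rho>"
  proof
    show "0 \<le> outcome_prob m \<rho> i" "0 \<le> outcome_prob n \<rho> j" for i j
      by (simp_all add: outcome_prob_form form_nonneg(1)[OF psd])
  qed (intro outcome_prob_sum joint_weight_marginal1 joint_weight_marginal2
      joint_weight_bilinear_bound joint_weight_le_overlap assms psd)+
  show ?thesis using assms(4-7) by (rule entropic_uncertainty)
qed

end
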